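(* Let $G$ be a connected general graph of even order, and let $f\colon V(G)\to\mathbb{Z}^+$ be a function. Then \[ o(G-S)\le \sum_{v\in S} f(v)\qquad\text{for every nonempty set } S\subset V(G) \] if and only if $G$ contains an $H$-factor for every function $H\colon V(G)\to 2^{\mathbb{N}}$ such that $H(v)\in\{J_f(v),\,J_f^+(v)\}$ for each $v\in V(G)$.
   Context: A general graph is a finite graph in which multiple edges and loops are allowed. For $S\subset V(G)$, $G-S$ is the subgraph obtained by deleting $S$, and $o(G-S)$ is the number of connected components of $G-S$ having an odd number of vertices. $\mathbb{Z}^+$ denotes the positive integers, $\mathbb{N}$ the nonnegative integers, and $2^{\mathbb{N}}$ the set of subsets of $\mathbb{N}$. For a set-valued function $H\colon V(G)\to 2^{\mathbb{N}}$, an $H$-factor of $G$ is a spanning subgraph $F$ of $G$ with $\deg_F(v)\in H(v)$ for every vertex $v$. For a positive integer $n$, $J_n=\{1,3,5,\dots,n\}$ if $n$ is odd and $J_n=\{1,3,5,\dots,n-1,n\}$ if $n$ is even; $J_f(v)=J_{f(v)}$. $J_f^+(v)$ is the set of positive odd integers $m$ with $m\le f(v)+1$. *)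

theory Defs
  imports Main "HOL-Library.Multiset"
begin

text \<open>
  The ends of an edge form a multiset of size two. So an edge of ends \<open>{#u, v#}\<close> is a link if
  \<open>u \<noteq> v\<close> and a loop if \<open>u = v\<close>, and distinct edges may have the same ends.
\<close>

record ('v, 'e) ggraph =
  verts :: "'v set"
  edges :: "'e set"
  ends :: "'e \<Rightarrow> 'v multiset"

definition general_graph :: "('v, 'e) ggraph \<Rightarrow> bool" where
  "general_graph G \<longleftrightarrow> finite (verts G) \<and> finite (edges G) \<and>
     (\<forall>e \<in> edges G. size (ends G e) = 2 \<and> set_mset (ends G e) \<subseteq> verts G)"

text \<open>A loop contributes two to the degree of its vertex.\<close>

definition degree :: "('v, 'e) ggraph \<Rightarrow> 'v \<Rightarrow> nat" where
  "degree G v = (\<Sum>e \<in> edges G. count (ends G e) v)"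

definition adjacent :: "('v, 'e) ggraph \<Rightarrow> 'v \<Rightarrow> 'v \<Rightarrow> bool" where
  "adjacent G u v \<longleftrightarrow> (\<exists>e \<in> edges G. ends G e = {#u, v#})"

definition joined :: "('v, 'e) ggraph \<Rightarrow> ('v \<times> 'v) set" where
  "joined G = {(u, v). u \<in> verts G \<and> v \<in> verts G \<and> (adjacent G)\<^sup>*\<^sup>* u v}"

definition connected_graph :: "('v, 'e) ggraph \<Rightarrow> bool" where
  "connected_graph G \<longleftrightarrow> verts G \<noteq> {} \<and> (\<forall>u \<in> verts G. \<forall>v \<in> verts G. (u, v) \<in> joined G)"

text \<open>A component is represented by its vertex set.\<close>

definition components :: "('v, 'e) ggraph \<Rightarrow> 'v set set" where
  "components G = verts G // joined G"

definition odd_components :: "('v, 'e) ggraph \<Rightarrow> nat" where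
  "odd_components G = card {C \<in> components G. odd (card C)}"

definition delete_verts :: "('v, 'e) ggraph \<Rightarrow> 'v set \<Rightarrow> ('v, 'e) ggraph" where
  "delete_verts G S =
     \<lparr>verts = verts G - S, edges = {e \<in> edges G. set_mset (ends G e) \<inter> S = {}}, ends = ends G\<rparr>"

definition spanning_subgraph :: "('v, 'e) ggraph \<Rightarrow> ('v, 'e) ggraph \<Rightarrow> bool" where
  "spanning_subgraph F G \<longleftrightarrow> verts F = verts G \<and> edges F \<subseteq> edges G \<and>
     (\<forall>e \<in> edges F. ends F e = ends G e)"

definition is_factor :: "('v \<Rightarrow> nat set) \<Rightarrow> ('v, 'e) ggraph \<Rightarrow> ('v, 'e) ggraph \<Rightarrow> bool" where
  "is_factor H G F \<longleftrightarrow> spanning_subgraph F G \<and> (\<forall>v \<in> verts G. degree F v \<in> H v)"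

text \<open>
  \<open>J n\<close> is \<open>{1, 3, 5, \<dots>, n}\<close> for odd \<open>n\<close> and \<open>{1, 3, 5, \<dots>, n - 1, n}\<close> for even positive \<open>n\<close>;
  it is only meant for positive \<open>n\<close>.
\<close>

definition J :: "nat \<Rightarrow> nat set" where
  "J n = (if odd n then {m. odd m \<and> m \<le> n} else {m. odd m \<and> m \<le> n - 1} \<union> {n})"

definition J_plus :: "nat \<Rightarrow> nat set" where
  "J_plus n = {m. odd m \<and> m \<le> n + 1}"

end

theory Submission
  imports Defs
begin

text \<open>
  Necessity is a parity count: if every degree off \<open>S\<close> is odd, each odd component of \<open>G - S\<close> sends a
  factor edge to \<open>S\<close>.

  For sufficiency, write \<open>h v\<close> for the largest element of \<open>H v\<close> and \<open>g v \<in> {h v - 1, h v}\<close> for its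
  largest odd element, and more generally prescribe degrees \<open>d\<close> with \<open>d \<le> g v\<close>, \<open>d \<equiv> g v\<close> mod 2, or
  \<open>d = h v\<close>, counting as odd the components \<open>C\<close> with \<open>\<Sum>v \<in> C. g v\<close> odd.  Choose \<open>S\<close> inclusion-maximal
  among the maximizers of \<open>o(G - S) - g(S)\<close>.  If \<open>S\<close> is empty, parity leaves a slack of two in every
  inequality and some \<open>g v\<close> can be lowered by two.  Otherwise optimality of \<open>S\<close> and the hypothesis are
  the two Hall conditions for attaching every odd component to a vertex of \<open>S\<close> so that each \<open>s \<in> S\<close>
  receives \<open>g s\<close> or \<open>h s\<close> of them, and maximality of \<open>S\<close> makes the induction hypothesis apply to each
  component with \<open>h = g\<close>, lowering \<open>g\<close> by one at the vertex where an odd component is attached.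
\<close>

section \<open>Components of a vertex set under a relation\<close>

text \<open>Connectivity is stated by cuts rather than by paths, so that a closed set meeting a
  connected one contains it without any induction along a path. Loops have no effect.\<close>

definition connected_on :: "('v \<Rightarrow> 'v \<Rightarrow> bool) \<Rightarrow> 'v set \<Rightarrow> bool" where
  "connected_on r C \<longleftrightarrow> C \<noteq> {} \<and>
     (\<forall>X \<subseteq> C. X \<noteq> {} \<longrightarrow> X \<noteq> C \<longrightarrow> (\<exists>x \<in> X. \<exists>y \<in> C - X. r x y))"

definition comps :: "('v \<Rightarrow> 'v \<Rightarrow> bool) \<Rightarrow> 'v set \<Rightarrow> 'v set set" where
  "comps r U = {C. C \<subseteq> U \<and> connected_on r C \<and> (\<forall>x \<in> C. \<forall>y \<in> U - C. \<not> r x y)}"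

text \<open>A general weight \<open>g\<close> is needed because the recursion lowers it by one at a
  vertex. When all weights are odd, these are the components of odd order.\<close>

definition odd_comps :: "('v \<Rightarrow> 'v \<Rightarrow> bool) \<Rightarrow> ('v \<Rightarrow> nat) \<Rightarrow> 'v set \<Rightarrow> 'v set set" where
  "odd_comps r g U = {C \<in> comps r U. odd (sum g C)}"

lemma compsD:
  assumes "C \<in> comps r U"
  shows "C \<subseteq> U" "connected_on r C" "C \<noteq> {}" "\<And>x y. x \<in> C \<Longrightarrow> y \<in> U \<Longrightarrow> r x y \<Longrightarrow> y \<in> C"
  using assms unfolding comps_def connected_on_def by auto

text \<open>Otherwise \<open>D \<inter> C\<close> would be a proper nonempty part of
  \<open>D\<close>, and an edge leaving it inside \<open>D\<close> would leave the closed set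
  \<open>C\<close>.\<close>

lemma connected_on_subset_comp:
  assumes "connected_on r D" "D \<subseteq> U" "C \<in> comps r U" "D \<inter> C \<noteq> {}"
  shows "D \<subseteq> C"
proof (rule ccontr)
  assume "\<not> D \<subseteq> C"
  then have "D \<inter> C \<noteq> D" by blast
  then obtain x y where "x \<in> D \<inter> C" "y \<in> D - D \<inter> C" "r x y"
    using assms(1,4) unfolding connected_on_def by (meson Int_lower1)
  then show False using compsD(4)[OF assms(3)] assms(2) by blast
qed

lemma comps_eqI:
  assumes "C \<in> comps r U" "D \<in> comps r U" "x \<in> C" "x \<in> D"
  shows "C = D"
  using connected_on_subset_comp[of r C U D] connected_on_subset_comp[of r D U C]
    compsD[OF assms(1)] compsD[OF assms(2)] assms by blast

lemma finite_comps [simp]: "finite U \<Longrightarrow> finite (comps r U)"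
  by (rule finite_subset[of _ "Pow U"]) (auto dest: compsD(1))

lemma finite_odd_comps [simp]: "finite U \<Longrightarrow> finite (odd_comps r g U)"
  by (simp add: odd_comps_def)

text \<open>A part that contains \<open>u\<close> and that no edge leaves absorbs every path from
  \<open>u\<close>. A part missing \<open>u\<close> is handled through its complement, with the
  crossing edge reversed by symmetry.\<close>

lemma connected_on_reachable:
  assumes "symp r"
  shows "connected_on r {v. (\<lambda>x y. r x y \<and> x \<in> U \<and> y \<in> U)\<^sup>*\<^sup>* u v}" (is "connected_on r ?C")
  unfolding connected_on_def
proof (intro conjI allI impI)
  let ?s = "\<lambda>x y. r x y \<and> x \<in> U \<and> y \<in> U"
  show "?C \<noteq> {}" by blast
  fix X assume X: "X \<subseteq> ?C" "X \<noteq> {}" "X \<noteq> ?C"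
  have cross: "\<exists>x \<in> A. \<exists>y \<in> ?C - A. r x y" if A: "u \<in> A" "A \<subseteq> ?C" "A \<noteq> ?C" for A
  proof (rule ccontr)
    assume no: "\<not> ?thesis"
    have "v \<in> A" if "?s\<^sup>*\<^sup>* u v" for v
      using that
    proof (induction rule: rtranclp_induct)
      case (step y z)
      then have "z \<in> ?C" by (auto intro: rtranclp.rtrancl_into_rtrancl)
      then show ?case using no step by blast
    qed (rule A(1))
    then show False using A by blast
  qed
  show "\<exists>x \<in> X. \<exists>y \<in> ?C - X. r x y"
  proof (cases "u \<in> X")
    case False
    then have "u \<in> ?C - X" by blast
    then obtain x y where "x \<in> ?C - X" "y \<in> ?C - (?C - X)" "r x y"
      using cross[of "?C - X"] X by blast
    then show ?thesis using X sympD[OF assms] by blast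
  qed (use cross X in blast)
qed

lemma reachable_in_comps:
  assumes "symp r" "u \<in> U"
  shows "{v. (\<lambda>x y. r x y \<and> x \<in> U \<and> y \<in> U)\<^sup>*\<^sup>* u v} \<in> comps r U" (is "?C \<in> _")
proof -
  let ?s = "\<lambda>x y. r x y \<and> x \<in> U \<and> y \<in> U"
  have sub: "?C \<subseteq> U"
    using assms(2) by (auto elim: rtranclp.cases)
  have "\<not> r x y" if "x \<in> ?C" "y \<in> U - ?C" for x y
  proof
    assume "r x y"
    then have "?s\<^sup>*\<^sup>* u x" "?s x y" using that sub by auto
    then have "?s\<^sup>*\<^sup>* u y" by (rule rtranclp.rtrancl_into_rtrancl)
    then show False using that(2) by simp
  qed
  then show ?thesis
    unfolding comps_def using sub connected_on_reachable[OF assms(1)] by blast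
qed

lemma Union_comps:
  assumes "symp r"
  shows "\<Union> (comps r U) = U"
  using reachable_in_comps[OF assms] compsD(1) by blast

lemma comps_connected:
  assumes "connected_on r C"
  shows "comps r C = {C}"
proof -
  have "C \<in> comps r C" using assms by (auto simp: comps_def)
  moreover have "D = C" if "D \<in> comps r C" for D
    using connected_on_subset_comp[OF assms _ that] compsD[OF that] by blast
  ultimately show ?thesis by blast
qed

text \<open>No edge joins \<open>C\<close> to the rest of \<open>U\<close>, so deleting vertices of
  \<open>C\<close> breaks up \<open>C\<close> alone.\<close>

lemma comps_Diff:
  assumes "symp r" "C \<in> comps r U" "T \<subseteq> C"
  shows "comps r (U - T) = (comps r U - {C}) \<union> comps r (C - T)"
proof (intro subset_antisym subsetI)
  fix D assume D: "D \<in> comps r (U - T)"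
  note d = compsD[OF D]
  show "D \<in> (comps r U - {C}) \<union> comps r (C - T)"
  proof (cases "D \<inter> C = {}")
    case True
    have "\<not> r x y" if "x \<in> D" "y \<in> U - D" for x y
    proof
      assume xy: "r x y"
      then have "y \<in> T" using d(4)[OF that(1) _ xy] that(2) by blast
      then have "x \<in> C"
        using compsD(4)[OF assms(2) _ _ sympD[OF assms(1) xy]] that(1) d(1) assms(3) by blast
      then show False using that(1) True by blast
    qed
    then have "D \<in> comps r U" using d(1,2) unfolding comps_def by blast
    moreover have "D \<noteq> C" using d(3) True by blast
    ultimately show ?thesis by blast
  next
    case False
    then have "D \<subseteq> C" using connected_on_subset_comp[OF d(2) _ assms(2)] d(1) by blast
    then have "D \<in> comps r (C - T)"
      using d(1,2,4) compsD(1)[OF assms(2)] unfolding comps_def by blast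
    then show ?thesis by blast
  qed
next
  fix D assume "D \<in> (comps r U - {C}) \<union> comps r (C - T)"
  then show "D \<in> comps r (U - T)"
  proof
    assume D: "D \<in> comps r U - {C}"
    then have "D \<inter> C = {}" using comps_eqI[OF _ assms(2)] by blast
    moreover have "D \<subseteq> U" "connected_on r D" "\<forall>x \<in> D. \<forall>y \<in> U - D. \<not> r x y"
      using D unfolding comps_def by blast+
    ultimately show ?thesis using assms(3) unfolding comps_def by blast
  next
    assume D: "D \<in> comps r (C - T)"
    note d = compsD[OF D]
    have "D \<subseteq> U - T" using d(1) compsD(1)[OF assms(2)] by blast
    moreover have "\<not> r x y" if "x \<in> D" "y \<in> U - T - D" for x y
    proof
      assume xy: "r x y"
      then have "y \<in> C" using compsD(4)[OF assms(2) _ _ xy] that d(1) by blast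
      then show False using d(4)[OF that(1) _ xy] that(2) by blast
    qed
    ultimately show ?thesis using d(2) unfolding comps_def by blast
  qed
qed

text \<open>Deletion exchanges \<open>C\<close> for the pieces of \<open>C - T\<close>. The
  \<open>of_bool\<close> term is the count lost with \<open>C\<close>, kept on the left to avoid
  subtraction.\<close>

lemma card_odd_comps_Diff:
  assumes "symp r" "finite U" "C \<in> comps r U" "T \<subseteq> C"
  shows "card (odd_comps r g (U - T)) + of_bool (odd (sum g C)) =
    card (odd_comps r g U) + card (odd_comps r g (C - T))"
proof -
  have fin: "finite C" using assms(2) compsD(1)[OF assms(3)] finite_subset by blast
  have disj: "(odd_comps r g U - {C}) \<inter> odd_comps r g (C - T) = {}"
  proof (rule ccontr)
    assume "\<not> ?thesis"
    then obtain D where D: "D \<in> comps r U" "D \<noteq> C" "D \<in> comps r (C - T)"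
      unfolding odd_comps_def by blast
    then show False using compsD[OF D(3)] comps_eqI[OF D(1) assms(3)] by blast
  qed
  have "odd_comps r g (U - T) = (odd_comps r g U - {C}) \<union> odd_comps r g (C - T)"
    unfolding odd_comps_def comps_Diff[OF assms(1,3,4)] by blast
  then have eq: "card (odd_comps r g (U - T)) =
      card (odd_comps r g U - {C}) + card (odd_comps r g (C - T))"
    using disj assms(2) fin by (simp add: card_Un_disjoint)
  show ?thesis
  proof (cases "odd (sum g C)")
    case True
    then have "C \<in> odd_comps r g U" using assms(3) by (simp add: odd_comps_def)
    then have "card (odd_comps r g U) = Suc (card (odd_comps r g U - {C}))"
      using assms(2) by (metis card.remove finite_odd_comps)
    then show ?thesis using eq True by simp
  next
    case False
    then have "C \<notin> odd_comps r g U" by (simp add: odd_comps_def)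
    then show ?thesis using eq False by simp
  qed
qed

text \<open>The components partition \<open>U\<close>, and modulo two only those of odd weight
  contribute to the sum.\<close>

lemma even_sum_card_odd_comps:
  assumes "symp r" "finite U"
  shows "even (sum g U) \<longleftrightarrow> even (card (odd_comps r g U))"
proof -
  have "sum g U = sum g (\<Union> (comps r U))" by (simp add: Union_comps[OF assms(1)])
  also have "\<dots> = (\<Sum>C \<in> comps r U. sum g C)"
  proof (subst sum.Union_disjoint)
    show "\<forall>A\<in>comps r U. finite A"
      using assms(2) compsD(1) finite_subset by metis
    show "\<forall>A\<in>comps r U. \<forall>B\<in>comps r U. A \<noteq> B \<longrightarrow> A \<inter> B = {}"
      using comps_eqI by (metis disjoint_iff)
  qed simp
  finally show ?thesis
    using assms(2) by (simp add: even_sum_iff odd_comps_def)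
qed

section \<open>A Hall-type assignment with lower and upper bounds\<close>

text \<open>
  In a minimal relation satisfying both Hall conditions every \<open>c\<close> has at most one neighbour: if the
  pairs \<open>(c, s)\<close> and \<open>(c, s')\<close> were both needed, uncrossing the two tight sets witnessing this would
  give a contradiction.
\<close>

lemma assignment_between_bounds:
  fixes f g :: "'b \<Rightarrow> nat" and R :: "('a \<times> 'b) set"
  assumes "finite Q" "finite S" "R \<subseteq> Q \<times> S" "\<And>s. s \<in> S \<Longrightarrow> g s \<le> f s"
    and "\<And>X. X \<subseteq> Q \<Longrightarrow> card X \<le> sum f (R `` X)"
    and "\<And>W. W \<subseteq> S \<Longrightarrow> sum g W \<le> card (R\<inverse> `` W)"
  shows "\<exists>\<phi>. (\<forall>c \<in> Q. (c, \<phi> c) \<in> R) \<and>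
      (\<forall>s \<in> S. g s \<le> card {c \<in> Q. \<phi> c = s} \<and> card {c \<in> Q. \<phi> c = s} \<le> f s)"
proof -
  have finR: "finite R" using assms(1-3) finite_subset by blast
  show ?thesis
    using finR assms(3,5,6)
  proof (induction R rule: finite_psubset_induct)
    case (psubset R)
    note RQS = \<open>R \<subseteq> Q \<times> S\<close> and up = psubset.prems(2) and low = psubset.prems(3)
    have fI: "finite (R `` X)" "R `` X \<subseteq> S" for X
      using RQS assms(2) finite_subset[of "R `` X" S] by auto
    have fC: "finite (R\<inverse> `` W)" "R\<inverse> `` W \<subseteq> Q" for W
      using RQS assms(1) finite_subset[of "R\<inverse> `` W" Q] by auto
    show ?case
    proof (cases "\<exists>p \<in> R. (\<forall>X \<subseteq> Q. card X \<le> sum f ((R - {p}) `` X)) \<and>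
        (\<forall>W \<subseteq> S. sum g W \<le> card ((R - {p})\<inverse> `` W))")
      case True
      then obtain p where p: "p \<in> R" "\<And>X. X \<subseteq> Q \<Longrightarrow> card X \<le> sum f ((R - {p}) `` X)"
        "\<And>W. W \<subseteq> S \<Longrightarrow> sum g W \<le> card ((R - {p})\<inverse> `` W)" by blast
      have "R - {p} \<subset> R" "R - {p} \<subseteq> Q \<times> S" using p(1) RQS by auto
      from psubset.IH[OF this p(2,3)] show ?thesis by blast
    next
      case False
      \<comment> \<open>Removing \<open>(c, s)\<close> breaks the upper condition at some
        \<open>X\<close> containing \<open>c\<close>. Here \<open>Y\<close> is
        \<open>X - {c}\<close> and \<open>P\<close> is what remains of the neighbourhood of
        \<open>X\<close>; dropping \<open>c\<close> turns the violation into
        \<open>sum f P \<le> card Y\<close>.\<close>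
      define up_tight where "up_tight c s Y P \<longleftrightarrow>
        Y \<subseteq> Q \<and> c \<notin> Y \<and> P = (R `` Y \<union> R `` {c}) - {s} \<and> s \<notin> R `` Y \<and> sum f P \<le> card Y" for c s Y P
      \<comment> \<open>Removing \<open>(c, s)\<close> breaks the lower condition at
        \<open>W\<close>. The only loss is \<open>c\<close> itself, so \<open>s\<close> is its sole
        neighbour in \<open>W\<close> and equality held before.\<close>
      define low_tight where "low_tight c s W \<longleftrightarrow>
        W \<subseteq> S \<and> s \<in> W \<and> R `` {c} \<inter> W = {s} \<and> card (R\<inverse> `` W) = sum g W" for c s W
      have tight: "(\<exists>Y P. up_tight c s Y P) \<or> (\<exists>W. low_tight c s W)" if cs: "(c, s) \<in> R" for c s
      proof -
        have "\<not> ((\<forall>X \<subseteq> Q. card X \<le> sum f ((R - {(c, s)}) `` X)) \<and>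
            (\<forall>W \<subseteq> S. sum g W \<le> card ((R - {(c, s)})\<inverse> `` W)))"
          using False cs by metis
        then consider X where "X \<subseteq> Q" "\<not> card X \<le> sum f ((R - {(c, s)}) `` X)"
          | W where "W \<subseteq> S" "\<not> sum g W \<le> card ((R - {(c, s)})\<inverse> `` W)"
          by metis
        then show ?thesis
        proof cases
          case 1
          then have ne: "(R - {(c, s)}) `` X \<noteq> R `` X" using up[of X] by auto
          then have c: "c \<in> X" "s \<notin> R `` (X - {c})" by blast+
          have im: "(R - {(c, s)}) `` X = (R `` (X - {c}) \<union> R `` {c}) - {s}"
            using c by blast
          have "card X = Suc (card (X - {c}))"
            using c(1) 1(1) assms(1) by (metis card.remove finite_subset)
          then have "up_tight c s (X - {c}) ((R - {(c, s)}) `` X)"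
            using 1 c im unfolding up_tight_def by auto
          then show ?thesis by blast
        next
          case 2
          then have ne: "(R - {(c, s)})\<inverse> `` W \<noteq> R\<inverse> `` W" using low[of W] by auto
          then have c: "s \<in> W" "R `` {c} \<inter> W = {s}" using cs by blast+
          have im: "R\<inverse> `` W = insert c ((R - {(c, s)})\<inverse> `` W)" "c \<notin> (R - {(c, s)})\<inverse> `` W"
            using ne cs c by blast+
          have "finite ((R - {(c, s)})\<inverse> `` W)"
            using im fC(1)[of W] by (metis finite_insert)
          then have "card (R\<inverse> `` W) = Suc (card ((R - {(c, s)})\<inverse> `` W))"
            using im by simp
          then have "card (R\<inverse> `` W) = sum g W" using 2 low[of W] by simp
          then show ?thesis using 2 c unfolding low_tight_def by blast
        qed
      qed
      \<comment> \<open>Since \<open>s \<noteq> s'\<close>, each of \<open>P\<close>,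
        \<open>P'\<close> contains the vertex missing from the other, so their union is the full
        neighbourhood of \<open>insert c (Y \<union> Y')\<close>. The extra element \<open>c\<close>
        is one more than the two tight bounds allow.\<close>
      have up_up: False if "up_tight c s Y P" "up_tight c s' Y' P'" "(c, s) \<in> R" "(c, s') \<in> R" "s \<noteq> s'"
        for c s s' Y Y' P P'
      proof -
        note y = that[unfolded up_tight_def]
        have fin: "finite Y" "finite Y'" "finite P" "finite P'"
          using y assms(1) fI(1) finite_subset by auto
        have "sum f P + sum f P' = sum f (P \<union> P') + sum f (P \<inter> P')"
          using fin by (simp add: sum.union_inter)
        moreover have "P \<union> P' = R `` insert c (Y \<union> Y')" using y by blast
        moreover have "sum f (R `` (Y \<inter> Y')) \<le> sum f (P \<inter> P')"
          by (rule sum_mono2) (use fin y in auto)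
        moreover have "card (insert c (Y \<union> Y')) \<le> sum f (R `` insert c (Y \<union> Y'))"
          by (rule up) (use y that(3) RQS in blast)
        moreover have "card (Y \<inter> Y') \<le> sum f (R `` (Y \<inter> Y'))"
          by (rule up) (use y in blast)
        moreover have "card (insert c (Y \<union> Y')) = Suc (card (Y \<union> Y'))"
          using y fin by simp
        moreover have "card Y + card Y' = card (Y \<union> Y') + card (Y \<inter> Y')"
          by (rule card_Un_Int) (use fin in auto)
        moreover have "sum f P \<le> card Y" "sum f P' \<le> card Y'" using y by blast+
        ultimately show False by simp
      qed
      \<comment> \<open>Here \<open>c\<close> is a neighbour of both \<open>W\<close> and
        \<open>W'\<close> but not of \<open>W \<inter> W'\<close>, which makes the submodular
        inequality strict by one.\<close>
      have low_low: False if "low_tight c s W" "low_tight c s' W'" "(c, s) \<in> R" "(c, s') \<in> R" "s \<noteq> s'"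
        for c s s' W W'
      proof -
        note w = that[unfolded low_tight_def]
        have fin: "finite W" "finite W'" using w assms(2) finite_subset by auto
        have "sum g W + sum g W' = sum g (W \<union> W') + sum g (W \<inter> W')"
          using fin by (simp add: sum.union_inter)
        moreover have "sum g (W \<union> W') \<le> card (R\<inverse> `` W \<union> R\<inverse> `` W')"
          using low[of "W \<union> W'"] w by (simp add: Image_Un)
        moreover have "sum g (W \<inter> W') \<le> card (R\<inverse> `` (W \<inter> W'))"
          by (rule low) (use w in auto)
        moreover have "card (insert c (R\<inverse> `` (W \<inter> W'))) \<le> card (R\<inverse> `` W \<inter> R\<inverse> `` W')"
        proof (rule card_mono)
          show "finite (R\<inverse> `` W \<inter> R\<inverse> `` W')" using fC(1) by blast
          show "insert c (R\<inverse> `` (W \<inter> W')) \<subseteq> R\<inverse> `` W \<inter> R\<inverse> `` W'"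
            using w that(3,4) by blast
        qed
        moreover have "card (insert c (R\<inverse> `` (W \<inter> W'))) = Suc (card (R\<inverse> `` (W \<inter> W')))"
        proof -
          have "R `` {c} \<inter> (W \<inter> W') = (R `` {c} \<inter> W) \<inter> (R `` {c} \<inter> W')" by blast
          also have "\<dots> = {s} \<inter> {s'}" using w by metis
          finally have "R `` {c} \<inter> (W \<inter> W') = {}" using that(5) by simp
          then have "c \<notin> R\<inverse> `` (W \<inter> W')" by blast
          then show ?thesis using fC(1) by simp
        qed
        moreover have "card (R\<inverse> `` W) + card (R\<inverse> `` W') =
            card (R\<inverse> `` W \<union> R\<inverse> `` W') + card (R\<inverse> `` W \<inter> R\<inverse> `` W')"
          by (rule card_Un_Int) (rule fC(1))+
        moreover have "card (R\<inverse> `` W) = sum g W" "card (R\<inverse> `` W') = sum g W'"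
          using w by blast+
        ultimately show False by simp
      qed
      \<comment> \<open>The upper condition is applied to the part of \<open>Y\<close> not adjacent
        to \<open>W\<close>, the lower one to \<open>W - P\<close>. No neighbour of
        \<open>W - P\<close> lies in \<open>Y\<close> or equals \<open>c\<close>, because
        \<open>s' \<in> P\<close>. Adding up forces
        \<open>sum f (P \<inter> W) < sum g (P \<inter> W)\<close>, against
        \<open>g \<le> f\<close>.\<close>
      have up_low: False if "up_tight c s Y P" "low_tight c s' W" "(c, s) \<in> R" "(c, s') \<in> R" "s \<noteq> s'"
        for c s s' Y P W
      proof -
        note y = that(1)[unfolded up_tight_def] and w = that(2)[unfolded low_tight_def]
        have PS: "P \<subseteq> S" using y fI(2) by blast
        have fin: "finite Y" "finite P" "finite W"
          using y w PS assms(1,2) finite_subset by blast+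
        have Y: "card Y = card (Y - R\<inverse> `` W) + card (Y \<inter> R\<inverse> `` W)"
          using fin by (metis add.commute card_Int_Diff)
        have "card (Y - R\<inverse> `` W) \<le> sum f (R `` (Y - R\<inverse> `` W))"
          by (rule up) (use y in auto)
        also have "\<dots> \<le> sum f (P - W)"
          by (rule sum_mono2) (use fin y in auto)
        finally have 1: "card (Y - R\<inverse> `` W) \<le> sum f (P - W)" .
        have 2: "sum f P = sum f (P - W) + sum f (P \<inter> W)"
          using fin by (metis add.commute sum.Int_Diff)
        have "s' \<in> P" using y that by blast
        then have sub: "R\<inverse> `` (W - P) \<subseteq> R\<inverse> `` W - insert c (Y \<inter> R\<inverse> `` W)"
          using y w that by blast
        have "sum g (W - P) \<le> card (R\<inverse> `` (W - P))"
          by (rule low) (use w in auto)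
        also have "\<dots> \<le> card (R\<inverse> `` W - insert c (Y \<inter> R\<inverse> `` W))"
          by (rule card_mono) (use sub fC(1) in auto)
        also have "\<dots> = card (R\<inverse> `` W) - card (insert c (Y \<inter> R\<inverse> `` W))"
          by (rule card_Diff_subset) (use fin that w in auto)
        also have "card (insert c (Y \<inter> R\<inverse> `` W)) = Suc (card (Y \<inter> R\<inverse> `` W))"
          using y fin by simp
        finally have 3: "sum g (W - P) \<le> card (R\<inverse> `` W) - Suc (card (Y \<inter> R\<inverse> `` W))" .
        \<comment> \<open>This guards the truncated subtraction in the preceding bound.\<close>
        have "card (insert c (Y \<inter> R\<inverse> `` W)) \<le> card (R\<inverse> `` W)"
          by (rule card_mono) (use fC(1) w that in auto)
        then have 4: "Suc (card (Y \<inter> R\<inverse> `` W)) \<le> card (R\<inverse> `` W)"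
          using y fin by simp
        have 5: "sum g W = sum g (W - P) + sum g (P \<inter> W)"
          using fin by (metis add.commute sum.Int_Diff Int_commute)
        have "sum g (P \<inter> W) \<le> sum f (P \<inter> W)"
          by (rule sum_mono) (use PS assms(4) in auto)
        moreover have "sum f P \<le> card Y" "card (R\<inverse> `` W) = sum g W" using y w by blast+
        ultimately show False using Y 1 2 3 4 5 by linarith
      qed
      have uniq: "s = s'" if "(c, s) \<in> R" "(c, s') \<in> R" for c s s'
        using tight[OF that(1)] tight[OF that(2)] up_up low_low up_low that by metis
      have "\<exists>s. (c, s) \<in> R" if "c \<in> Q" for c
      proof (rule ccontr)
        assume "\<not> ?thesis"
        then have "R `` {c} = {}" by blast
        then show False using up[of "{c}"] that by simp
      qed
      then obtain \<phi> where \<phi>: "\<And>c. c \<in> Q \<Longrightarrow> (c, \<phi> c) \<in> R" by metis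
      have inv: "R\<inverse> `` {s} = {c \<in> Q. \<phi> c = s}" for s
        using \<phi> uniq RQS by blast
      \<comment> \<open>With \<open>R\<close> the graph of \<phi>, the lower condition at
        \<open>{s}\<close> and the upper condition at the fibre over \<open>s\<close> are the two
        bounds.\<close>
      have "g s \<le> card {c \<in> Q. \<phi> c = s} \<and> card {c \<in> Q. \<phi> c = s} \<le> f s" if "s \<in> S" for s
      proof
        show "g s \<le> card {c \<in> Q. \<phi> c = s}" using low[of "{s}"] that inv by simp
        have "card {c \<in> Q. \<phi> c = s} \<le> sum f (R `` {c \<in> Q. \<phi> c = s})"
          by (rule up) auto
        also have "\<dots> \<le> sum f {s}"
          by (rule sum_mono2) (use \<phi> uniq in auto)
        finally show "card {c \<in> Q. \<phi> c = s} \<le> f s" by simp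
      qed
      then show ?thesis using \<phi> by blast
    qed
  qed
qed

section \<open>Parity factors within a connected vertex set\<close>

lemma sum_upd_diff:
  fixes g :: "'a \<Rightarrow> nat"
  assumes "finite W" "v \<in> W" "k \<le> g v"
  shows "sum (g(v := g v - k)) W + k = sum g W"
  using assms by (simp add: sum.remove[of W v])

lemma sum_upd_other: "v \<notin> W \<Longrightarrow> sum (g(v := a)) W = sum g W"
  by (rule sum.cong) auto

lemma less_same_parity: "a < b \<Longrightarrow> even a \<longleftrightarrow> even b \<Longrightarrow> a + 2 \<le> b" for a b :: nat
  by presburger

text \<open>An edge without ends would fit inside every component. Excluding it lets the edge sets
  chosen for different components be disjoint.\<close>

locale edge_family =
  fixes E :: "'e set" and ends :: "'e \<Rightarrow> 'v multiset"
  assumes finite_E: "finite E" and ends_nonempty: "\<And>e. e \<in> E \<Longrightarrow> ends e \<noteq> {#}"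
begin

definition adj :: "'v \<Rightarrow> 'v \<Rightarrow> bool" where
  "adj u v \<longleftrightarrow> (\<exists>e \<in> E. ends e = {#u, v#})"

definition deg :: "'e set \<Rightarrow> 'v \<Rightarrow> nat" where
  "deg F v = (\<Sum>e \<in> F. count (ends e) v)"

lemma symp_adj: "symp adj"
  by (rule sympI) (auto simp: adj_def add_mset_commute)

lemma deg_eq_0: "(\<And>e. e \<in> F \<Longrightarrow> v \<notin># ends e) \<Longrightarrow> deg F v = 0"
  by (simp add: deg_def not_in_iff)

theorem parity_factor_exists:
  fixes f g :: "'v \<Rightarrow> nat"
  assumes "finite U" "connected_on adj U" "even (sum g U)"
    and "\<And>v. v \<in> U \<Longrightarrow> g v \<le> f v \<and> f v \<le> g v + 1"
    and "\<And>T. T \<subseteq> U \<Longrightarrow> T \<noteq> {} \<Longrightarrow> card (odd_comps adj g (U - T)) \<le> sum f T"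
  shows "\<exists>F \<subseteq> E. (\<forall>e \<in> F. set_mset (ends e) \<subseteq> U) \<and>
    (\<forall>v \<in> U. deg F v \<le> g v \<and> even (deg F v + g v) \<or> deg F v = f v)"
  using assms
proof (induction "card U + sum g U" arbitrary: U f g rule: less_induct)
  case (less U g f)
  note finU = less.prems(1) and conU = less.prems(2) and evenU = less.prems(3)
    and fg = less.prems(4) and cond = less.prems(5)
  \<comment> \<open>With the upper bound equal to \<open>h\<close>, attaining it is an instance of
    the parity condition, so the second alternative disappears.\<close>
  have IH: "\<exists>F \<subseteq> E. (\<forall>e \<in> F. set_mset (ends e) \<subseteq> C) \<and>
      (\<forall>v \<in> C. deg F v \<le> h v \<and> even (deg F v + h v))"
    if "card C + sum h C < card U + sum g U" "finite C" "connected_on adj C" "even (sum h C)"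
      "\<And>T. T \<subseteq> C \<Longrightarrow> T \<noteq> {} \<Longrightarrow> card (odd_comps adj h (C - T)) \<le> sum h T" for C h
  proof -
    have "h v \<le> h v \<and> h v \<le> h v + 1" for v by simp
    from less.hyps[OF that(1-4) this that(5)] show ?thesis
      by (metis even_add le_refl)
  qed
  define \<Phi> where "\<Phi> T = int (card (odd_comps adj g (U - T))) - int (sum g T)" for T
  obtain S where S: "S \<subseteq> U" "\<And>T. T \<subseteq> U \<Longrightarrow> \<Phi> T \<le> \<Phi> S"
    "\<And>T. T \<subseteq> U \<Longrightarrow> S \<subset> T \<Longrightarrow> \<Phi> T < \<Phi> S"
  proof -
    define M where "M = Max (\<Phi> ` Pow U)"
    have M: "M \<in> \<Phi> ` Pow U" "\<And>T. T \<subseteq> U \<Longrightarrow> \<Phi> T \<le> M"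
      unfolding M_def using finU by (auto intro!: Max_in)
    have "finite {T \<in> Pow U. \<Phi> T = M}" "{T \<in> Pow U. \<Phi> T = M} \<noteq> {}"
      using finU M(1) by auto
    from finite_has_maximal[OF this] obtain S where
      S: "S \<subseteq> U" "\<Phi> S = M" "\<And>T. T \<subseteq> U \<Longrightarrow> \<Phi> T = M \<Longrightarrow> S \<subseteq> T \<Longrightarrow> S = T" by auto
    show thesis
    proof (rule that[of S])
      show "\<Phi> T < \<Phi> S" if "T \<subseteq> U" "S \<subset> T" for T
        using S(3)[OF that(1)] M(2)[OF that(1)] S(2) that(2) by fastforce
    qed (use S M in auto)
  qed
  have parity: "even (card (odd_comps adj g W)) \<longleftrightarrow> even (sum g W)" if "W \<subseteq> U" for W
    using even_sum_card_odd_comps[OF symp_adj] finite_subset[OF that finU] by metis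
  show ?case
  proof (cases "S = {}")
    case True
    have "\<Phi> {} = 0"
      using evenU comps_connected[OF conU] by (simp add: \<Phi>_def odd_comps_def card_eq_0_iff)
    have slack: "card (odd_comps adj g (U - T)) + 2 \<le> sum g T" if T: "T \<subseteq> U" "T \<noteq> {}" for T
    proof -
      have "card (odd_comps adj g (U - T)) < sum g T"
      proof -
        have "S \<subset> T" using T(2) True by blast
        then have "\<Phi> T < 0" using S(3)[OF T(1)] True \<open>\<Phi> {} = 0\<close> by metis
        then show ?thesis unfolding \<Phi>_def by linarith
      qed
      moreover have "sum g U = sum g T + sum g (U - T)"
        using T(1) finU by (metis add.commute sum.subset_diff)
      then have "even (card (odd_comps adj g (U - T))) \<longleftrightarrow> even (sum g T)"
        using parity[of "U - T"] evenU by auto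
      ultimately show ?thesis by (rule less_same_parity)
    qed
    obtain v where v: "v \<in> U" using conU by (auto simp: connected_on_def)
    \<comment> \<open>The slack at a singleton ensures that subtracting two from \<open>g v\<close>
      is not truncated.\<close>
    have gv: "2 \<le> g v" using slack[of "{v}"] v by simp
    let ?h = "g(v := g v - 2)"
    \<comment> \<open>A change by two keeps every parity, hence the odd components.\<close>
    have par: "odd (sum ?h W) \<longleftrightarrow> odd (sum g W)" if "W \<subseteq> U" for W
    proof (cases "v \<in> W")
      case True
      then have "sum ?h W + 2 = sum g W"
        using sum_upd_diff[OF finite_subset[OF that finU], of v 2 g] gv by simp
      then show ?thesis by (metis dvd_refl even_add)
    qed (simp add: sum_upd_other del: fun_upd_apply)
    have odd_eq: "odd_comps adj ?h W = odd_comps adj g W" if "W \<subseteq> U" for W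
      unfolding odd_comps_def using par compsD(1) that by (metis (no_types, lifting) subset_trans)
    have "\<exists>F \<subseteq> E. (\<forall>e \<in> F. set_mset (ends e) \<subseteq> U) \<and>
      (\<forall>u \<in> U. deg F u \<le> ?h u \<and> even (deg F u + ?h u))"
    proof (rule IH[OF _ finU conU])
      show "card U + sum ?h U < card U + sum g U"
        using sum_upd_diff[OF finU v, of 2 g] gv by simp
      show "even (sum ?h U)" using par[of U] evenU by blast
      fix T assume T: "T \<subseteq> U" "T \<noteq> {}"
      \<comment> \<open>Lowering one value costs the right-hand side at most two, which the slack
        pays.\<close>
      have "sum g T \<le> sum ?h T + 2"
      proof (cases "v \<in> T")
        case True
        then show ?thesis using sum_upd_diff[OF finite_subset[OF T(1) finU], of v 2 g] gv by simp
      qed (simp add: sum_upd_other del: fun_upd_apply)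
      then show "card (odd_comps adj ?h (U - T)) \<le> sum ?h T"
        using slack[OF T] odd_eq[of "U - T"] by auto
    qed
    then obtain F where F: "F \<subseteq> E" "\<forall>e \<in> F. set_mset (ends e) \<subseteq> U"
      "\<And>u. u \<in> U \<Longrightarrow> deg F u \<le> ?h u \<and> even (deg F u + ?h u)" by blast
    have "deg F u \<le> g u \<and> even (deg F u + g u)" if "u \<in> U" for u
      using F(3)[OF that] gv by (cases "u = v") auto
    then show ?thesis using F(1,2) by blast
  next
    case False
    let ?K = "comps adj (U - S)"
    define Q where "Q = odd_comps adj g (U - S)"
    have finUS: "finite (U - S)" and finS: "finite S" using finU S(1) finite_subset by auto
    have QK: "Q \<subseteq> ?K" unfolding Q_def odd_comps_def by blast
    have finQ: "finite Q" unfolding Q_def using finUS by simp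
    \<comment> \<open>This compares \<open>S\<close> with the larger set
      \<open>S \<union> T\<close>: the pieces of \<open>C - T\<close> replace \<open>C\<close>,
      which was counted only if odd.\<close>
    have comp_bound: "card (odd_comps adj g (C - T)) < sum g T + of_bool (odd (sum g C))"
      if C: "C \<in> ?K" "T \<subseteq> C" "T \<noteq> {}" for C T
    proof -
      have CU: "C \<subseteq> U - S" using compsD(1)[OF C(1)] .
      have T: "S \<union> T \<subseteq> U" "S \<subset> S \<union> T" "S \<inter> T = {}" "finite T"
        using CU C S(1) finite_subset[OF _ finU] by blast+
      have "sum g (S \<union> T) = sum g S + sum g T"
        using sum.union_disjoint[OF finS T(4,3)] .
      moreover have "U - (S \<union> T) = U - S - T" by blast
      ultimately have "int (card (odd_comps adj g (U - S - T))) - int (sum g S + sum g T) <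
          int (card (odd_comps adj g (U - S))) - int (sum g S)"
        using S(3)[OF T(1,2)] by (metis \<Phi>_def)
      then show ?thesis
        using card_odd_comps_Diff[OF symp_adj finUS C(1,2), of g] by linarith
    qed
    define R where "R = {(C, s). C \<in> Q \<and> s \<in> S \<and> (\<exists>x \<in> C. adj x s)}"
    \<comment> \<open>If all attachments of \<open>C\<close> lie in \<open>W\<close>, putting
      \<open>S - W\<close> back into the graph leaves \<open>C\<close> an odd component.\<close>
    have stays: "C \<in> odd_comps adj g (U - W)" if C: "C \<in> Q" "W \<subseteq> S" "R `` {C} \<subseteq> W" for C W
    proof -
      have K: "C \<in> ?K" "odd (sum g C)" using C(1) unfolding Q_def odd_comps_def by blast+
      have "\<not> adj x y" if "x \<in> C" "y \<in> U - W - C" for x y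
      proof
        assume xy: "adj x y"
        show False
        proof (cases "y \<in> S")
          case True
          then have "y \<in> R `` {C}" using C(1) that(1) xy unfolding R_def by blast
          then show False using C(3) that(2) by blast
        next
          case False
          then show False using compsD(4)[OF K(1) that(1) _ xy] that(2) by blast
        qed
      qed
      moreover have "C \<subseteq> U - W" using compsD(1)[OF K(1)] C(2) by blast
      ultimately show ?thesis
        using compsD(2)[OF K(1)] K(2) unfolding odd_comps_def comps_def by blast
    qed
    \<comment> \<open>An unattached \<open>C\<close> would be a component of the connected set
      \<open>U\<close>, hence all of \<open>U\<close>, although \<open>S\<close> is
      nonempty.\<close>
    have attached: "R `` {C} \<noteq> {}" if "C \<in> Q" for C
    proof
      assume "R `` {C} = {}"
      then have "C \<in> comps adj U" using stays[OF that, of "{}"] unfolding odd_comps_def by simp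
      then have "C = U" using comps_connected[OF conU] by simp
      then show False using that QK compsD(1) S(1) False by blast
    qed
    have "\<exists>\<phi>. (\<forall>C \<in> Q. (C, \<phi> C) \<in> R) \<and>
      (\<forall>s \<in> S. g s \<le> card {C \<in> Q. \<phi> C = s} \<and> card {C \<in> Q. \<phi> C = s} \<le> f s)"
    proof (rule assignment_between_bounds[OF finQ finS, of R g f])
      show "R \<subseteq> Q \<times> S" unfolding R_def by blast
      show "g s \<le> f s" if "s \<in> S" for s using fg S(1) that by blast
      \<comment> \<open>The hypothesis is used at the neighbourhood of \<open>X\<close>, whose
        deletion still leaves every member of \<open>X\<close> an odd component.\<close>
      show "card X \<le> sum f (R `` X)" if X: "X \<subseteq> Q" for X
      proof (cases "X = {}")
        case False
        have W: "R `` X \<subseteq> S" unfolding R_def by blast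
        have "R `` X \<noteq> {}" using attached X False by blast
        then have "card (odd_comps adj g (U - R `` X)) \<le> sum f (R `` X)"
          using cond W S(1) by blast
        moreover have "X \<subseteq> odd_comps adj g (U - R `` X)"
          using stays[OF _ W] X by blast
        ultimately show ?thesis
          using card_mono[of "odd_comps adj g (U - R `` X)" X] finU by simp
      qed simp
      \<comment> \<open>Putting \<open>W\<close> back keeps each odd component not attached to
        \<open>W\<close>, so \<Phi>\<open>(S - W) \<le>\<close>\<Phi>\<open>S\<close> bounds
        \<open>sum g W\<close> by the number of attached ones.\<close>
      show "sum g W \<le> card (R\<inverse> `` W)" if W: "W \<subseteq> S" for W
      proof -
        have "Q - R\<inverse> `` W \<subseteq> odd_comps adj g (U - (S - W))"
        proof
          fix C assume C: "C \<in> Q - R\<inverse> `` W"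
          then have "R `` {C} \<subseteq> S - W" unfolding R_def by blast
          then show "C \<in> odd_comps adj g (U - (S - W))" using stays[of C "S - W"] C by blast
        qed
        then have "card (Q - R\<inverse> `` W) \<le> card (odd_comps adj g (U - (S - W)))"
          using finU by (intro card_mono) auto
        moreover have "card Q - card (R\<inverse> `` W) \<le> card (Q - R\<inverse> `` W)"
          by (rule diff_card_le_card_Diff) (rule finite_subset[OF _ finQ], auto simp: R_def)
        moreover have "\<Phi> (S - W) \<le> \<Phi> S" using S(1,2) by blast
        moreover have "sum g S = sum g (S - W) + sum g W"
          using W finS by (rule sum.subset_diff)
        ultimately show ?thesis unfolding \<Phi>_def Q_def by linarith
      qed
    qed
    then obtain \<phi> where \<phi>: "\<And>C. C \<in> Q \<Longrightarrow> (C, \<phi> C) \<in> R"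
      "\<And>s. s \<in> S \<Longrightarrow> g s \<le> card {C \<in> Q. \<phi> C = s}"
      "\<And>s. s \<in> S \<Longrightarrow> card {C \<in> Q. \<phi> C = s} \<le> f s" by blast
    \<comment> \<open>Each component receives its own edges. Only the edge chosen to attach an odd
      component to \<phi>\<open>C\<close> reaches \<open>S\<close>.\<close>
    have "\<forall>C \<in> ?K. \<exists>F. F \<subseteq> E \<and>
        (\<forall>e \<in> F. set_mset (ends e) \<inter> C \<noteq> {} \<and> set_mset (ends e) \<subseteq> C \<union> S) \<and>
        (\<forall>v \<in> C. deg F v \<le> g v \<and> even (deg F v + g v)) \<and>
        (\<forall>s \<in> S. deg F s = of_bool (C \<in> Q \<and> \<phi> C = s))" (is "\<forall>C \<in> ?K. \<exists>F. ?P C F")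
    proof
      fix C assume C: "C \<in> ?K"
      note c = compsD[OF C]
      have finC: "finite C" using c(1) finUS finite_subset by blast
      have CU: "C \<subset> U" using c(1) S(1) False by blast
      have size: "card C + sum g C < card U + sum g U"
        by (rule add_less_le_mono) (use CU finU in \<open>auto intro: psubset_card_mono sum_mono2\<close>)
      show "\<exists>F. ?P C F"
      proof (cases "C \<in> Q")
        case False
        then have ev: "even (sum g C)" using C unfolding Q_def odd_comps_def by blast
        have bound: "card (odd_comps adj g (C - T)) \<le> sum g T" if "T \<subseteq> C" "T \<noteq> {}" for T
          using comp_bound[OF C that] ev by simp
        obtain F where F: "F \<subseteq> E" "\<And>e. e \<in> F \<Longrightarrow> set_mset (ends e) \<subseteq> C"
          "\<forall>v \<in> C. deg F v \<le> g v \<and> even (deg F v + g v)"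
          using IH[OF size finC c(2) ev bound] by blast
        have "deg F s = 0" if "s \<in> S" for s
          by (rule deg_eq_0) (use F(2) c(1) that in blast)
        moreover have "set_mset (ends e) \<inter> C \<noteq> {} \<and> set_mset (ends e) \<subseteq> C \<union> S"
          if "e \<in> F" for e
          using F(1) F(2)[OF that] ends_nonempty[of e] that by (auto simp: Int_absorb2)
        ultimately show ?thesis using F False by (intro exI[of _ F]) auto
      next
        case True
        then have od: "odd (sum g C)" unfolding Q_def odd_comps_def by blast
        obtain x where x: "x \<in> C" "adj x (\<phi> C)" and \<phi>S: "\<phi> C \<in> S"
          using \<phi>(1)[OF True] unfolding R_def by blast
        obtain e where e: "e \<in> E" "ends e = {#x, \<phi> C#}" using x(2) unfolding adj_def by blast
        \<comment> \<open>For odd \<open>C\<close> the earlier bound gives only a weak inequality;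
          parity excludes equality.\<close>
        have lt: "card (odd_comps adj g (C - T)) < sum g T" if T: "T \<subseteq> C" "T \<noteq> {}" for T
        proof -
          have "sum g C = sum g (C - T) + sum g T" using T(1) finC by (rule sum.subset_diff)
          then have "even (card (odd_comps adj g (C - T))) \<longleftrightarrow> odd (sum g T)"
            using parity[of "C - T"] CU od by auto
          then have "card (odd_comps adj g (C - T)) \<noteq> sum g T" by auto
          then show ?thesis using comp_bound[OF C T] od by simp
        qed
        have gx: "1 \<le> g x" using lt[of "{x}"] x(1) by simp
        \<comment> \<open>The attaching edge will supply the missing unit of degree at
          \<open>x\<close>.\<close>
        let ?h = "g(x := g x - 1)"
        have h: "sum ?h W + 1 = sum g W" if "x \<in> W" "W \<subseteq> C" for W
          using sum_upd_diff[OF finite_subset[OF that(2) finC] that(1), of 1 g] gx by simp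
        have "\<exists>F \<subseteq> E. (\<forall>e \<in> F. set_mset (ends e) \<subseteq> C) \<and>
          (\<forall>v \<in> C. deg F v \<le> ?h v \<and> even (deg F v + ?h v))"
        proof (rule IH[OF _ finC c(2)])
          show "card C + sum ?h C < card U + sum g U" using h[OF x(1) order_refl] size by simp
          show "even (sum ?h C)" using h[OF x(1) order_refl] od by (metis even_plus_one_iff)
          fix T assume T: "T \<subseteq> C" "T \<noteq> {}"
          have finCT: "finite (C - T)" using finC by simp
          show "card (odd_comps adj ?h (C - T)) \<le> sum ?h T"
          proof (cases "x \<in> T")
            \<comment> \<open>No remaining component contains \<open>x\<close>, so only the
              right-hand side drops by one, which strictness covers.\<close>
            case True
            have "sum ?h D = sum g D" if "D \<in> comps adj (C - T)" for D
              using sum_upd_other[of x D] compsD(1)[OF that] True by blast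
            then have "odd_comps adj ?h (C - T) = odd_comps adj g (C - T)"
              unfolding odd_comps_def by auto
            then show ?thesis using lt[OF T] h[OF True T(1)] by simp
          next
            \<comment> \<open>Only the component containing \<open>x\<close> changes parity, so the
              count grows by at most one, again covered by strictness.\<close>
            case False
            then obtain D where D: "D \<in> comps adj (C - T)" "x \<in> D"
              using Union_comps[OF symp_adj, of "C - T"] x(1) by blast
            have "sum ?h D' = sum g D'" if "D' \<in> comps adj (C - T)" "D' \<noteq> D" for D'
              using sum_upd_other[of x D'] comps_eqI[OF that(1) D(1), of x] that(2) D(2) by blast
            then have "odd_comps adj ?h (C - T) \<subseteq> insert D (odd_comps adj g (C - T))"
              unfolding odd_comps_def by fastforce
            then have "card (odd_comps adj ?h (C - T)) \<le> card (insert D (odd_comps adj g (C - T)))"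
              using finCT by (intro card_mono) auto
            also have "\<dots> \<le> Suc (card (odd_comps adj g (C - T)))"
              by (rule card_insert_le_m1) auto
            finally have "card (odd_comps adj ?h (C - T)) \<le> Suc (card (odd_comps adj g (C - T)))" .
            then show ?thesis using lt[OF T] sum_upd_other[OF False, of g] by simp
          qed
        qed
        then obtain F where F: "F \<subseteq> E" "\<And>e. e \<in> F \<Longrightarrow> set_mset (ends e) \<subseteq> C"
          "\<And>v. v \<in> C \<Longrightarrow> deg F v \<le> ?h v \<and> even (deg F v + ?h v)" by blast
        have \<phi>C: "\<phi> C \<notin> C" using \<phi>S c(1) by blast
        have "e \<notin> F" using F(2)[of e] e(2) \<phi>C by auto
        moreover have "finite F" using F(1) finite_E finite_subset by blast
        ultimately have ins: "deg (insert e F) v = count {#x, \<phi> C#} v + deg F v" for v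
          by (simp add: deg_def e(2))
        have "deg F s = 0" if "s \<in> S" for s
          by (rule deg_eq_0) (use F(2) c(1) that in blast)
        moreover have "x \<notin> S" using x(1) c(1) by blast
        ultimately have "deg (insert e F) s = of_bool (C \<in> Q \<and> \<phi> C = s)" if "s \<in> S" for s
          using ins that True by auto
        moreover have "deg (insert e F) v \<le> g v \<and> even (deg (insert e F) v + g v)"
          if "v \<in> C" for v
          using F(3)[OF that] ins[of v] gx \<phi>C that by (cases "v = x") auto
        moreover have "set_mset (ends e') \<inter> C \<noteq> {} \<and> set_mset (ends e') \<subseteq> C \<union> S"
          if "e' \<in> insert e F" for e'
        proof (cases "e' = e")
          case True
          then show ?thesis using e(2) x(1) \<phi>S by auto
        next
          case False
          then have "e' \<in> F" using that by blast
          then show ?thesis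
            using F(1) F(2)[of e'] ends_nonempty[of e'] by (auto simp: Int_absorb2)
        qed
        ultimately show ?thesis using F(1) e(1) by (intro exI[of _ "insert e F"]) auto
      qed
    qed
    from bchoice[OF this] obtain F where P: "\<forall>C \<in> ?K. ?P C (F C)" by blast
    have F: "\<And>C. C \<in> ?K \<Longrightarrow> F C \<subseteq> E"
      "\<And>C e. C \<in> ?K \<Longrightarrow> e \<in> F C \<Longrightarrow> set_mset (ends e) \<inter> C \<noteq> {} \<and> set_mset (ends e) \<subseteq> C \<union> S"
      "\<And>C v. C \<in> ?K \<Longrightarrow> v \<in> C \<Longrightarrow> deg (F C) v \<le> g v \<and> even (deg (F C) v + g v)"
      "\<And>C s. C \<in> ?K \<Longrightarrow> s \<in> S \<Longrightarrow> deg (F C) s = of_bool (C \<in> Q \<and> \<phi> C = s)"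
      using P by blast+
    let ?F = "\<Union>C \<in> ?K. F C"
    have finK: "finite ?K" using finUS by simp
    have disj: "C \<inter> D = {}" if "C \<in> ?K" "D \<in> ?K" "C \<noteq> D" for C D
      using comps_eqI[OF that(1,2)] that(3) by blast
    have deg_F: "deg ?F v = (\<Sum>C \<in> ?K. deg (F C) v)" for v
      unfolding deg_def
    proof (rule sum.UNION_disjoint[OF finK])
      show "\<forall>C \<in> ?K. finite (F C)" using F(1) finite_E finite_subset by metis
      show "\<forall>C \<in> ?K. \<forall>D \<in> ?K. C \<noteq> D \<longrightarrow> F C \<inter> F D = {}"
      proof (intro ballI impI)
        fix C D assume CD: "C \<in> ?K" "D \<in> ?K" "C \<noteq> D"
        \<comment> \<open>A common edge would have an end in \<open>D\<close>, which is disjoint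
          from \<open>C \<union> S\<close>.\<close>
        have "e \<notin> F D" if "e \<in> F C" for e
        proof
          assume "e \<in> F D"
          then obtain x where x: "x \<in># ends e" "x \<in> D" using F(2)[OF CD(2)] by blast
          then have "x \<in> C \<union> S" using F(2)[OF CD(1) that] by blast
          then show False using disj[OF CD] compsD(1)[OF CD(2)] x(2) by blast
        qed
        then show "F C \<inter> F D = {}" by blast
      qed
    qed
    show ?thesis
    proof (intro exI[of _ ?F] conjI ballI)
      show "?F \<subseteq> E" using F(1) by blast
      show "set_mset (ends e) \<subseteq> U" if "e \<in> ?F" for e
      proof -
        obtain C where C: "C \<in> ?K" "e \<in> F C" using \<open>e \<in> ?F\<close> by blast
        show ?thesis using F(2)[OF C] compsD(1)[OF C(1)] S(1) by blast
      qed
      fix v assume v: "v \<in> U"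
      show "deg ?F v \<le> g v \<and> even (deg ?F v + g v) \<or> deg ?F v = f v"
      proof (cases "v \<in> S")
        case True
        have "deg ?F v = (\<Sum>C \<in> ?K. of_bool (C \<in> Q \<and> \<phi> C = v))"
          unfolding deg_F by (rule sum.cong) (use F(4) True in auto)
        also have "\<dots> = card {C \<in> Q. \<phi> C = v}"
        proof -
          have "?K \<inter> {C. C \<in> Q \<and> \<phi> C = v} = {C \<in> Q. \<phi> C = v}" using QK by blast
          then show ?thesis using finK by (simp add: sum_of_bool_eq)
        qed
        finally have "deg ?F v = card {C \<in> Q. \<phi> C = v}" .
        \<comment> \<open>The degree lies between \<open>g v\<close> and \<open>f v\<close>, which
          differ by at most one.\<close>
        then have "deg ?F v = g v \<or> deg ?F v = f v"
          using \<phi>(2,3)[OF True] fg[OF v] by linarith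
        then show ?thesis by auto
      next
        case False
        then obtain C where C: "C \<in> ?K" "v \<in> C"
          using Union_comps[OF symp_adj, of "U - S"] v by blast
        have "deg (F D) v = 0" if "D \<in> ?K - {C}" for D
        proof (rule deg_eq_0)
          fix e assume "e \<in> F D"
          then have "set_mset (ends e) \<subseteq> D \<union> S" using F(2)[of D e] that by blast
          moreover have "v \<notin> D" using disj[of D C] that C by blast
          ultimately show "v \<notin># ends e" using False by blast
        qed
        then have "deg ?F v = deg (F C) v"
          unfolding deg_F using sum.remove[OF finK C(1), of "\<lambda>D. deg (F D) v"] by simp
        then show ?thesis using F(3)[OF C] by simp
      qed
    qed
  qed
qed

end

section \<open>Components of a general graph through its adjacency relation\<close>

lemma symp_adjacent: "symp (adjacent G)"
  by (rule sympI) (auto simp: adjacent_def add_mset_commute)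

text \<open>A component coincides with the set reachable from any of its vertices, since the two
  overlap and both are components.\<close>

lemma comps_eq_quotient:
  assumes "symp r"
  shows "comps r U = U // {(u, v). u \<in> U \<and> v \<in> U \<and> (\<lambda>x y. r x y \<and> x \<in> U \<and> y \<in> U)\<^sup>*\<^sup>* u v}"
    (is "_ = U // ?E")
proof -
  let ?C = "\<lambda>u. {v. (\<lambda>x y. r x y \<and> x \<in> U \<and> y \<in> U)\<^sup>*\<^sup>* u v}"
  have img: "?E `` {u} = ?C u" if "u \<in> U" for u
    using that compsD(1)[OF reachable_in_comps[OF assms that]] by blast
  have "C \<in> U // ?E" if C: "C \<in> comps r U" for C
  proof -
    obtain u where u: "u \<in> C" using compsD(3)[OF C] by blast
    then have uU: "u \<in> U" using compsD(1)[OF C] by blast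
    have "C = ?C u"
      by (rule comps_eqI[OF C reachable_in_comps[OF assms uU] u]) blast
    then have "C = ?E `` {u}" by (simp only: img[OF uU])
    then show ?thesis using quotientI[OF uU, of ?E] by (simp only:)
  qed
  moreover have "C \<in> comps r U" if "C \<in> U // ?E" for C
    using that
  proof (rule quotientE)
    fix u assume "C = ?E `` {u}" and u: "u \<in> U"
    then have "C = ?C u" by (simp only: img[OF u])
    then show ?thesis using reachable_in_comps[OF assms u] by (simp only:)
  qed
  ultimately show ?thesis by blast
qed

text \<open>Ends of edges lie in \<open>verts G\<close>, so adjacency after the deletion is
  adjacency in \<open>G\<close> restricted to the remaining vertices.\<close>

lemma joined_delete_verts:
  assumes "general_graph G"
  shows "joined (delete_verts G S) = {(u, v). u \<in> verts G - S \<and> v \<in> verts G - S \<and>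
    (\<lambda>x y. adjacent G x y \<and> x \<in> verts G - S \<and> y \<in> verts G - S)\<^sup>*\<^sup>* u v}"
proof -
  have "adjacent (delete_verts G S) =
      (\<lambda>x y. adjacent G x y \<and> x \<in> verts G - S \<and> y \<in> verts G - S)"
  proof (intro ext iffI)
    fix x y assume "adjacent (delete_verts G S) x y"
    then obtain e where "e \<in> edges G" "set_mset (ends G e) \<inter> S = {}" "ends G e = {#x, y#}"
      unfolding adjacent_def delete_verts_def by auto
    moreover from this have "set_mset (ends G e) \<subseteq> verts G"
      using assms unfolding general_graph_def by blast
    ultimately show "adjacent G x y \<and> x \<in> verts G - S \<and> y \<in> verts G - S"
      unfolding adjacent_def by auto
  next
    fix x y assume "adjacent G x y \<and> x \<in> verts G - S \<and> y \<in> verts G - S"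
    then show "adjacent (delete_verts G S) x y"
      unfolding adjacent_def delete_verts_def by auto
  qed
  moreover have "verts (delete_verts G S) = verts G - S" by (simp add: delete_verts_def)
  ultimately show ?thesis unfolding joined_def by (simp only:)
qed

lemma components_delete_verts:
  assumes "general_graph G"
  shows "components (delete_verts G S) = comps (adjacent G) (verts G - S)"
proof -
  have "verts (delete_verts G S) = verts G - S" by (simp add: delete_verts_def)
  then show ?thesis
    unfolding components_def by (simp only: joined_delete_verts[OF assms] comps_eq_quotient[OF symp_adjacent])
qed

lemma connected_graph_imp_connected_on:
  assumes "general_graph G" "connected_graph G"
  shows "connected_on (adjacent G) (verts G)"
proof -
  have con: "verts G \<noteq> {}" "\<And>u v. u \<in> verts G \<Longrightarrow> v \<in> verts G \<Longrightarrow> (u, v) \<in> joined G"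
    using assms(2) unfolding connected_graph_def by simp_all
  then obtain u where u: "u \<in> verts G" by auto
  \<comment> \<open>Viewing \<open>G\<close> as a deletion of nothing makes the description of
    \<open>joined\<close> available.\<close>
  have G: "delete_verts G {} = G" unfolding delete_verts_def by simp
  let ?C = "{v. (\<lambda>x y. adjacent G x y \<and> x \<in> verts G \<and> y \<in> verts G)\<^sup>*\<^sup>* u v}"
  have "verts G \<subseteq> ?C"
  proof
    fix v assume "v \<in> verts G"
    then have "(u, v) \<in> joined G" using con(2)[OF u] by simp
    then show "v \<in> ?C" using joined_delete_verts[OF assms(1), of "{}"] unfolding G by simp
  qed
  have C: "?C \<in> comps (adjacent G) (verts G)"
    by (rule reachable_in_comps[OF symp_adjacent u])
  have "?C = verts G" using compsD(1)[OF C] \<open>verts G \<subseteq> ?C\<close> by (rule subset_antisym)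
  then show ?thesis using compsD(2)[OF C] by (simp only:)
qed

section \<open>Necessity by counting factor edges\<close>

lemma odd_components_le_sum_degree:
  assumes G: "general_graph G" and F: "spanning_subgraph F G" and S: "S \<subseteq> verts G"
    and odd_deg: "\<And>v. v \<in> verts G - S \<Longrightarrow> odd (degree F v)"
  shows "odd_components (delete_verts G S) \<le> (\<Sum>v \<in> S. degree F v)"
proof -
  let ?K = "{C \<in> comps (adjacent G) (verts G - S). odd (card C)}"
  have FG: "edges F \<subseteq> edges G" "\<And>e. e \<in> edges F \<Longrightarrow> ends F e = ends G e"
    using F unfolding spanning_subgraph_def by blast+
  have fin: "finite (verts G)" "finite (edges F)"
    using G finite_subset[OF FG(1)] unfolding general_graph_def by simp_all
  have finS: "finite S" using S fin(1) finite_subset by blast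
  have "\<exists>e \<in> edges F. \<exists>x \<in> C. \<exists>s \<in> S. ends F e = {#x, s#}" if C: "C \<in> ?K" for C
  proof (rule ccontr)
    assume no: "\<not> ?thesis"
    have CK: "C \<in> comps (adjacent G) (verts G - S)" and oddC: "odd (card C)" using C by auto
    note c = compsD[OF CK]
    have finC: "finite C" using c(1) fin(1) finite_subset by blast
    \<comment> \<open>With no edge of \<open>F\<close> from \<open>C\<close> to \<open>S\<close>,
      each edge of \<open>F\<close> has both ends in \<open>C\<close> or neither.\<close>
    have "even (\<Sum>v \<in> C. count (ends F e) v)" if e: "e \<in> edges F" for e
    proof -
      have eG: "e \<in> edges G" using e FG(1) by blast
      then have "size (ends G e) = 2" "set_mset (ends G e) \<subseteq> verts G"
        using G unfolding general_graph_def by auto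
      moreover from this obtain x M where M: "ends G e = add_mset x M" "size M = 1"
        using size_eq_Suc_imp_eq_union[of "ends G e" 1] by auto
      moreover from M(2) obtain y where "M = {#y#}" using size_1_singleton_mset by blast
      ultimately obtain x y where xy: "ends G e = {#x, y#}" "x \<in> verts G" "y \<in> verts G"
        by auto
      have eq: "ends F e = {#x, y#}" "ends F e = {#y, x#}"
        using FG(2)[OF e] xy(1) by (auto simp: add_mset_commute)
      have adj: "adjacent G x y" "adjacent G y x"
        using eG xy(1) sympD[OF symp_adjacent] unfolding adjacent_def by (auto simp: add_mset_commute)
      have "x \<in> C \<longleftrightarrow> y \<in> C"
        using no e eq adj xy(2,3) c(4) by (metis DiffI)
      \<comment> \<open>Two separate indicators let a loop count twice.\<close>
      moreover have "(\<Sum>v \<in> C. count {#x, y#} v) =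
          (\<Sum>v \<in> C. (if v = x then 1 else 0) + (if v = y then 1 else 0))"
        by (rule sum.cong) auto
      ultimately show ?thesis unfolding eq(1) using finC by (simp add: sum.distrib)
    qed
    then have "even (\<Sum>e \<in> edges F. \<Sum>v \<in> C. count (ends F e) v)" by (rule dvd_sum)
    then have "even (\<Sum>v \<in> C. degree F v)" unfolding degree_def by (subst sum.swap)
    moreover have "{v \<in> C. odd (degree F v)} = C" using odd_deg c(1) by blast
    ultimately show False using oddC finC by (simp add: even_sum_iff)
  qed
  then have "\<forall>C \<in> ?K. \<exists>e. e \<in> edges F \<and> (\<exists>x \<in> C. \<exists>s \<in> S. ends F e = {#x, s#})"
    by blast
  from bchoice[OF this] obtain \<epsilon> where \<epsilon>: "\<And>C. C \<in> ?K \<Longrightarrow> \<epsilon> C \<in> edges F"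
    "\<And>C. C \<in> ?K \<Longrightarrow> \<exists>x \<in> C. \<exists>s \<in> S. ends F (\<epsilon> C) = {#x, s#}" by blast
  \<comment> \<open>The chosen edge has exactly one end outside \<open>S\<close>, and that end
    determines the component.\<close>
  have inj: "inj_on \<epsilon> ?K"
  proof (rule inj_onI)
    fix C D assume CD: "C \<in> ?K" "D \<in> ?K" and eq: "\<epsilon> C = \<epsilon> D"
    obtain x s where xs: "x \<in> C" "s \<in> S" "ends F (\<epsilon> C) = {#x, s#}"
      using \<epsilon>(2)[OF CD(1)] by blast
    obtain y t where yt: "y \<in> D" "t \<in> S" "ends F (\<epsilon> D) = {#y, t#}"
      using \<epsilon>(2)[OF CD(2)] by blast
    have K: "C \<in> comps (adjacent G) (verts G - S)" "D \<in> comps (adjacent G) (verts G - S)"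
      using CD by simp_all
    have "x \<notin> S" "y \<notin> S" using xs(1) yt(1) compsD(1)[OF K(1)] compsD(1)[OF K(2)] by blast+
    moreover have "{#x, s#} = {#y, t#}" using xs(3) yt(3) eq by simp
    ultimately have "x = y" using xs(2) yt(2) by (auto simp: add_eq_conv_ex)
    then show "C = D" using comps_eqI[OF K xs(1)] yt(1) by simp
  qed
  have "odd_components (delete_verts G S) = card ?K"
    unfolding odd_components_def components_delete_verts[OF G] ..
  also have "\<dots> = (\<Sum>e \<in> \<epsilon> ` ?K. 1)" using inj by (simp add: card_image)
  also have "\<dots> \<le> (\<Sum>e \<in> \<epsilon> ` ?K. \<Sum>v \<in> S. count (ends F e) v)"
  proof (rule sum_mono)
    fix e assume "e \<in> \<epsilon> ` ?K"
    then obtain x s where "s \<in> S" "ends F e = {#x, s#}" using \<epsilon>(2) by blast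
    then have "1 \<le> count (ends F e) s" by simp
    also have "\<dots> \<le> (\<Sum>v \<in> S. count (ends F e) v)"
      using \<open>s \<in> S\<close> finS by (intro member_le_sum) auto
    finally show "1 \<le> (\<Sum>v \<in> S. count (ends F e) v)" .
  qed
  also have "\<dots> \<le> (\<Sum>e \<in> edges F. \<Sum>v \<in> S. count (ends F e) v)"
    by (rule sum_mono2) (use fin \<epsilon>(1) in auto)
  also have "\<dots> = (\<Sum>v \<in> S. degree F v)" unfolding degree_def by (rule sum.swap)
  finally show ?thesis .
qed

theorem theorem2p2:
  fixes G :: "('v, 'e) ggraph" and f :: "'v \<Rightarrow> nat"
  assumes "general_graph G"
    and "connected_graph G"
    and "even (card (verts G))"
    and "\<forall>v \<in> verts G. f v > 0"
  shows "(\<forall>S. S \<subseteq> verts G \<and> S \<noteq> {} \<longrightarrow> odd_components (delete_verts G S) \<le> (\<Sum>v \<in> S. f v))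
    \<longleftrightarrow> (\<forall>H :: 'v \<Rightarrow> nat set. (\<forall>v \<in> verts G. H v \<in> {J (f v), J_plus (f v)})
           \<longrightarrow> (\<exists>F :: ('v, 'e) ggraph. is_factor H G F))"
proof (intro iffI allI impI)
  fix H :: "'v \<Rightarrow> nat set"
  assume tough: "\<forall>S. S \<subseteq> verts G \<and> S \<noteq> {} \<longrightarrow>
      odd_components (delete_verts G S) \<le> (\<Sum>v \<in> S. f v)"
    and H: "\<forall>v \<in> verts G. H v \<in> {J (f v), J_plus (f v)}"
  have fin: "finite (verts G)" "finite (edges G)"
    using assms(1) unfolding general_graph_def by auto
  interpret edge_family "edges G" "ends G"
    by unfold_locales (use assms(1) fin in \<open>auto simp: general_graph_def\<close>)
  have adj: "adj = adjacent G" by (intro ext) (simp add: adj_def adjacent_def)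
  \<comment> \<open>For odd \<open>f v\<close> the two allowed sets coincide, with largest element
    \<open>f v\<close>. Only for even \<open>f v\<close> does \<open>J_plus\<close> reach
    \<open>f v + 1\<close>.\<close>
  define h where "h v = (if even (f v) \<and> H v = J_plus (f v) then f v + 1 else f v)" for v
  define g where "g v = (if even (h v) then h v - 1 else h v)" for v
  have hpos: "h v > 0" if "v \<in> verts G" for v using assms(4) that unfolding h_def by auto
  have gh: "g v \<le> h v \<and> h v \<le> g v + 1" for v unfolding g_def by auto
  have godd: "odd (g v)" if "v \<in> verts G" for v
    using hpos[OF that] unfolding g_def by auto
  have allowed: "d \<in> H v" if "v \<in> verts G" "d \<le> g v \<and> even (d + g v) \<or> d = h v" for v d
    using that godd[OF that(1)] H assms(4)
    by (auto simp: g_def h_def J_def J_plus_def split: if_splits)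
  \<comment> \<open>All values of \<open>g\<close> are odd here, so weighted parity is parity of the
    order.\<close>
  have parity: "odd (sum g C) \<longleftrightarrow> odd (card C)" if "C \<subseteq> verts G" for C
  proof -
    have "{v \<in> C. odd (g v)} = C" using godd that by blast
    then show ?thesis using finite_subset[OF that fin(1)] by (simp add: even_sum_iff)
  qed
  have cond: "card (odd_comps adj g (verts G - T)) \<le> sum h T"
    if T: "T \<subseteq> verts G" "T \<noteq> {}" for T
  proof -
    have "odd_comps adj g (verts G - T) =
        {C \<in> components (delete_verts G T). odd (card C)}"
      unfolding odd_comps_def components_delete_verts[OF assms(1)] adj
      using parity compsD(1) by (metis (lifting) Diff_subset subset_trans)
    then have "card (odd_comps adj g (verts G - T)) \<le> sum f T"
      using tough T unfolding odd_components_def by simp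
    also have "\<dots> \<le> sum h T" by (rule sum_mono) (simp add: h_def)
    finally show ?thesis .
  qed
  have con: "connected_on adj (verts G)"
    unfolding adj by (rule connected_graph_imp_connected_on[OF assms(1,2)])
  have ev: "even (sum g (verts G))" using parity[of "verts G"] assms(3) by blast
  obtain F where F: "F \<subseteq> edges G"
    "\<And>v. v \<in> verts G \<Longrightarrow> deg F v \<le> g v \<and> even (deg F v + g v) \<or> deg F v = h v"
    using parity_factor_exists[OF fin(1) con ev gh cond] by blast
  let ?F = "\<lparr>verts = verts G, edges = F, ends = ends G\<rparr>"
  have "is_factor H G ?F"
    unfolding is_factor_def spanning_subgraph_def
    using F allowed by (simp add: degree_def deg_def)
  then show "\<exists>F. is_factor H G F" by blast
next
  fix S
  assume all: "\<forall>H. (\<forall>v \<in> verts G. H v \<in> {J (f v), J_plus (f v)}) \<longrightarrow>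
      (\<exists>F :: ('v, 'e) ggraph. is_factor H G F)"
    and S: "S \<subseteq> verts G \<and> S \<noteq> {}"
  \<comment> \<open>\<open>J\<close> on \<open>S\<close> caps the degrees there by \<open>f\<close>,
    while \<open>J_plus\<close> off \<open>S\<close> forces odd degrees, as the counting
    requires.\<close>
  let ?H = "\<lambda>v. if v \<in> S then J (f v) else J_plus (f v)"
  have "?H v \<in> {J (f v), J_plus (f v)}" if "v \<in> verts G" for v by simp
  from all[rule_format, OF this] obtain F :: "('v, 'e) ggraph" where F: "is_factor ?H G F"
    by blast
  have "odd_components (delete_verts G S) \<le> (\<Sum>v \<in> S. degree F v)"
  proof (rule odd_components_le_sum_degree[OF assms(1)])
    show "odd (degree F v)" if "v \<in> verts G - S" for v
      using F that unfolding is_factor_def by (auto simp: J_plus_def)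
  qed (use F S in \<open>auto simp: is_factor_def\<close>)
  also have "\<dots> \<le> (\<Sum>v \<in> S. f v)"
  proof (rule sum_mono)
    fix v assume v: "v \<in> S"
    then have "v \<in> verts G" using S by blast
    then have "degree F v \<in> ?H v" using F unfolding is_factor_def by blast
    then have "degree F v \<in> J (f v)" using v by simp
    then show "degree F v \<le> f v" by (auto simp: J_def split: if_splits)
  qed
  finally show "odd_components (delete_verts G S) \<le> (\<Sum>v \<in> S. f v)" .
qed

end
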